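(* Let $f$ be a real-valued function on pairs of non-negative integers which is symmetric ($f(x,y)=f(y,x)$) and monotone (if $x\le x'$ and $y\le y'$ then $f(x,y)\le f(x',y')$), and let $Q(G)=\sum_{uv\in E(G)}f(d(u),d(v))$. Then for every $n$ there is an integer $0\le m\le n$ such that the maximum of $Q(G)$ over all $n$-vertex triangle-free graphs $G$ equals $Q(K_{m,n-m})$.
   Context: Graphs are finite and simple; $d(v)$ denotes the degree of $v$ in $G$. $K_{m,n-m}$ is the complete bipartite graph with parts of sizes $m$ and $n-m$. *)

theory Defs
  imports Complex_Main
begin

text \<open>A graph is a pair of its vertex set and its edge set; edges are two-element vertex sets.\<close>

type_synonym 'a graph = "'a set \<times> 'a set set"

definition simple_graph :: "'a graph \<Rightarrow> bool" where
  "simple_graph G \<longleftrightarrow> finite (fst G) \<and>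
     snd G \<subseteq> {{u, v} | u v. u \<in> fst G \<and> v \<in> fst G \<and> u \<noteq> v}"

definition degree :: "'a graph \<Rightarrow> 'a \<Rightarrow> nat" where
  "degree G v = card {u \<in> fst G. {u, v} \<in> snd G}"

text \<open>The three vertices below are automatically distinct in a simple graph.\<close>

definition triangle_free :: "'a graph \<Rightarrow> bool" where
  "triangle_free G \<longleftrightarrow> \<not> (\<exists>u v w. {u, v} \<in> snd G \<and> {v, w} \<in> snd G \<and> {u, w} \<in> snd G)"

text \<open>The term \<open>f(d(u),d(v))\<close> of an unordered edge \<open>uv\<close>: the definite description is
  well defined because \<open>f\<close> is symmetric wherever it is used.\<close>

definition edge_weight :: "(nat \<Rightarrow> nat \<Rightarrow> real) \<Rightarrow> 'a graph \<Rightarrow> 'a set \<Rightarrow> real" where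
  "edge_weight f G e = (THE r. \<exists>u v. e = {u, v} \<and> r = f (degree G u) (degree G v))"

definition Q :: "(nat \<Rightarrow> nat \<Rightarrow> real) \<Rightarrow> 'a graph \<Rightarrow> real" where
  "Q f G = (\<Sum>e\<in>snd G. edge_weight f G e)"

definition complete_bipartite :: "nat \<Rightarrow> nat \<Rightarrow> nat graph" where
  "complete_bipartite a b = ({0..<a + b}, {{i, j} | i j. i \<in> {0..<a} \<and> j \<in> {a..<a + b}})"

end

theory Submission
  imports Defs
begin

text \<open>
  Let \<open>M\<close> be the maximum of \<open>m (n - m) f(m, n - m)\<close> over \<open>m \<le> n\<close>; taking \<open>m = 0\<close> shows \<open>M \<ge> 0\<close>.
  Adjacent vertices of a triangle-free graph satisfy \<open>d(u) + d(v) \<le> n\<close>, so by monotonicity an edge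
  \<open>uv\<close> weighs at most \<open>f(d(u), n - d(u)) \<le> M / (d(u) (n - d(u)))\<close>, and likewise with \<open>v\<close> in place of
  \<open>u\<close>. Averaging the two bounds and summing over the edges gives \<open>Q(G) \<le> M/2 * \<Sum>\<^sub>v 1 / (n - d(v))\<close>.
  The last sum is at most \<open>2\<close>: if \<open>w\<close> has maximum degree \<open>D\<close>, each of its \<open>D\<close> neighbours has degree
  at most \<open>n - D\<close> and contributes at most \<open>1 / D\<close>, and each of the other \<open>n - D\<close> vertices contributes
  at most \<open>1 / (n - D)\<close>.
\<close>

definition neighbours :: "'a graph \<Rightarrow> 'a \<Rightarrow> 'a set" where
  "neighbours G v = {u \<in> fst G. {u, v} \<in> snd G}"

text \<open>\<open>complete_bipartite\<close> lives on \<open>nat\<close>, whereas the competing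
  graphs live on sets \<open>V\<close> of an arbitrary type; this polymorphic form serves
  both.\<close>

definition bipartite_on :: "'a set \<Rightarrow> 'a set \<Rightarrow> 'a graph" where
  "bipartite_on A B = (A \<union> B, {{a, b} | a b. a \<in> A \<and> b \<in> B})"

section \<open>Degrees and incidences\<close>

lemma degree_eq_card_neighbours: "degree G v = card (neighbours G v)"
  by (simp add: degree_def neighbours_def)

lemma simple_graph_edgeE:
  assumes "simple_graph G" "e \<in> snd G"
  obtains u v where "e = {u, v}" "u \<in> fst G" "v \<in> fst G" "u \<noteq> v"
  using assms unfolding simple_graph_def by blast

lemma simple_graph_finite_edges:
  assumes "simple_graph G"
  shows "finite (snd G)"
proof (rule finite_subset)
  show "snd G \<subseteq> Pow (fst G)"
    using assms by (auto elim!: simple_graph_edgeE)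
  show "finite (Pow (fst G))"
    using assms by (simp add: simple_graph_def)
qed

lemma neighbours_subset:
  assumes "simple_graph G"
  shows "neighbours G v \<subseteq> fst G - {v}"
proof -
  have "{v, v} \<notin> snd G"
    using assms by (auto elim: simple_graph_edgeE)
  then show ?thesis
    by (auto simp: neighbours_def)
qed

text \<open>No vertex neighbours itself, so the inclusion is strict. This keeps the denominators
  \<open>n - d(v)\<close> positive.\<close>

lemma degree_less_card:
  assumes "simple_graph G" "v \<in> fst G"
  shows "degree G v < card (fst G)"
  unfolding degree_eq_card_neighbours
  using assms neighbours_subset[OF assms(1), of v]
  by (intro psubset_card_mono) (auto simp: simple_graph_def)

text \<open>A common neighbour of \<open>u\<close> and \<open>v\<close> would close a triangle, so
  the two neighbourhoods are disjoint.\<close>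

lemma degree_sum_le:
  assumes "simple_graph G" "triangle_free G" "{u, v} \<in> snd G"
  shows "degree G u + degree G v \<le> card (fst G)"
proof -
  have fin: "finite (fst G)"
    using assms(1) by (simp add: simple_graph_def)
  have "neighbours G u \<inter> neighbours G v = {}"
  proof (rule ccontr)
    assume "neighbours G u \<inter> neighbours G v \<noteq> {}"
    then obtain w where "{w, u} \<in> snd G" "{w, v} \<in> snd G"
      by (auto simp: neighbours_def)
    then have "{u, v} \<in> snd G \<and> {v, w} \<in> snd G \<and> {u, w} \<in> snd G"
      using assms(3) by (simp add: insert_commute)
    then show False
      using assms(2) unfolding triangle_free_def by blast
  qed
  then have "degree G u + degree G v = card (neighbours G u \<union> neighbours G v)"
    unfolding degree_eq_card_neighbours using fin
    by (subst card_Un_disjoint) (auto simp: neighbours_def)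
  also have "\<dots> \<le> card (fst G)"
    using fin by (intro card_mono) (auto simp: neighbours_def)
  finally show ?thesis .
qed

lemma card_incident_edges:
  assumes "simple_graph G"
  shows "card {e \<in> snd G. v \<in> e} = degree G v"
proof -
  have "e \<in> (\<lambda>u. {u, v}) ` neighbours G v" if e: "e \<in> snd G" "v \<in> e" for e
  proof -
    from assms e(1) obtain x y where "e = {x, y}" "x \<in> fst G" "y \<in> fst G"
      by (rule simple_graph_edgeE)
    then show ?thesis
      using e by (auto simp: neighbours_def insert_commute)
  qed
  then have "{e \<in> snd G. v \<in> e} = (\<lambda>u. {u, v}) ` neighbours G v"
    by (auto simp: neighbours_def)
  moreover have "inj_on (\<lambda>u. {u, v}) (neighbours G v)"
    by (auto simp: inj_on_def doubleton_eq_iff)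
  ultimately show ?thesis
    by (simp add: card_image degree_eq_card_neighbours)
qed

text \<open>Double counting of incidences: \<open>c x\<close> is counted once for each edge at
  \<open>x\<close>.\<close>

lemma sum_edges_eq_sum_vertices:
  fixes c :: "'a \<Rightarrow> real"
  assumes "simple_graph G"
  shows "(\<Sum>e\<in>snd G. \<Sum>x\<in>e. c x) = (\<Sum>x\<in>fst G. real (degree G x) * c x)"
proof -
  have "(\<Sum>e\<in>snd G. \<Sum>x\<in>e. c x) = (\<Sum>e\<in>snd G. \<Sum>x\<in>{x \<in> fst G. x \<in> e}. c x)"
    using assms by (intro sum.cong refl) (auto elim!: simple_graph_edgeE)
  also have "\<dots> = (\<Sum>x\<in>fst G. \<Sum>e\<in>{e \<in> snd G. x \<in> e}. c x)"
    using assms simple_graph_finite_edges[OF assms]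
    by (intro sum.swap_restrict) (simp_all add: simple_graph_def)
  finally show ?thesis
    by (simp add: card_incident_edges[OF assms])
qed

section \<open>The upper bound\<close>

lemma edge_weight_doubleton:
  assumes "\<And>x y. f x y = f y x"
  shows "edge_weight f G {u, v} = f (degree G u) (degree G v)"
  unfolding edge_weight_def
  by (rule the_equality) (use assms in \<open>auto simp: doubleton_eq_iff\<close>)

lemma sum_inverse_codegree_le:
  assumes "simple_graph G" "triangle_free G"
  shows "(\<Sum>v\<in>fst G. 1 / (real (card (fst G)) - real (degree G v))) \<le> 2"
proof (cases "fst G = {}")
  case False
  let ?n = "card (fst G)"
  let ?h = "\<lambda>v. 1 / (real ?n - real (degree G v))"
  have fin: "finite (fst G)"
    using assms(1) by (simp add: simple_graph_def)
  define D where "D = Max (degree G ` fst G)"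
  have "D \<in> degree G ` fst G"
    unfolding D_def using fin False by (intro Max_in) auto
  then obtain w where w: "w \<in> fst G" "degree G w = D"
    by auto
  have le_D: "degree G v \<le> D" if "v \<in> fst G" for v
    unfolding D_def using fin that by simp
  have "D < ?n"
    using degree_less_card[OF assms(1) w(1)] w(2) by simp
  let ?N = "neighbours G w"
  have N: "?N \<subseteq> fst G" "card ?N = D"
    using w(2) by (auto simp: neighbours_def degree_eq_card_neighbours)
  have "?h v \<le> 1 / real D" if "v \<in> ?N" for v
  proof -
    have "degree G v + D \<le> ?n"
      using degree_sum_le[OF assms, of v w] that w(2) by (simp add: neighbours_def)
    \<comment> \<open>Division by zero yields 0, so the bound \<open>1 / real D\<close> needs
      \<open>D\<close> positive; the neighbour \<open>v\<close> of \<open>w\<close> ensures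
      it.\<close>
    moreover have "D > 0"
      using that N(2) finite_subset[OF N(1) fin] by (auto simp: card_gt_0_iff)
    ultimately show ?thesis
      by (intro divide_left_mono) auto
  qed
  then have "sum ?h ?N \<le> real D * (1 / real D)"
    using sum_bounded_above[of ?N ?h "1 / real D"] N by simp
  \<comment> \<open>Only an inequality: for \<open>D = 0\<close> the product is 0.\<close>
  also have "\<dots> \<le> 1"
    by simp
  finally have inner: "sum ?h ?N \<le> 1" .
  have card_rest: "real (card (fst G - ?N)) = real ?n - real D"
    using N fin \<open>D < ?n\<close> by (simp add: card_Diff_subset finite_subset of_nat_diff)
  have "?h v \<le> 1 / (real ?n - real D)" if "v \<in> fst G - ?N" for v
    using le_D[of v] that \<open>D < ?n\<close> by (intro divide_left_mono) auto
  then have "sum ?h (fst G - ?N) \<le> (real ?n - real D) * (1 / (real ?n - real D))"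
    using sum_bounded_above[of "fst G - ?N" ?h "1 / (real ?n - real D)"] card_rest by simp
  also have "\<dots> = 1"
    using \<open>D < ?n\<close> by simp
  finally show ?thesis
    using inner sum.subset_diff[OF N(1) fin, of ?h] by linarith
qed simp

text \<open>Here \<open>m\<close> and \<open>k\<close> stand for the degrees of the two ends of an
  edge. Monotonicity raises \<open>k\<close> to \<open>n - m\<close>, and \<open>0 < m < n\<close>
  permits the division.\<close>

lemma edge_weight_le:
  fixes f :: "nat \<Rightarrow> nat \<Rightarrow> real"
  assumes mono: "\<And>x x' y y'. x \<le> x' \<Longrightarrow> y \<le> y' \<Longrightarrow> f x y \<le> f x' y'"
    and bound: "real (m * (n - m)) * f m (n - m) \<le> M"
    and "0 < m" "m < n" "m + k \<le> n"
  shows "f m k \<le> M / (real m * (real n - real m))"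
proof -
  have "f m k \<le> f m (n - m)"
    using assms by (intro mono) auto
  also have "\<dots> \<le> M / (real m * (real n - real m))"
    using assms by (simp add: pos_le_divide_eq of_nat_diff mult_ac)
  finally show ?thesis .
qed

lemma Q_le:
  fixes f :: "nat \<Rightarrow> nat \<Rightarrow> real"
  assumes sym: "\<And>x y. f x y = f y x"
    and mono: "\<And>x x' y y'. x \<le> x' \<Longrightarrow> y \<le> y' \<Longrightarrow> f x y \<le> f x' y'"
    and G: "simple_graph G" "triangle_free G" "card (fst G) = n"
    and bound: "\<And>m. m \<le> n \<Longrightarrow> real (m * (n - m)) * f m (n - m) \<le> M"
  shows "Q f G \<le> M"
proof -
  have "M \<ge> 0"
    using bound[of 0] by simp
  \<comment> \<open>Each end of an edge is charged half of its weight; \<open>c v\<close> bounds the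
    charge to \<open>v\<close> and depends on \<open>v\<close> alone, so the sum over edges can
    become a sum over vertices.\<close>
  define c where "c v = M / (real (degree G v) * (real n - real (degree G v))) / 2" for v
  have half: "f (degree G u) (degree G v) / 2 \<le> c u"
    if "{u, v} \<in> snd G" "u \<in> fst G" "v \<in> fst G" for u v
  proof -
    have "v \<in> neighbours G u"
      using that by (simp add: neighbours_def insert_commute)
    then have "0 < degree G u"
      using G(1) by (auto simp: degree_eq_card_neighbours card_gt_0_iff neighbours_def simple_graph_def)
    moreover have "degree G u < n"
      using degree_less_card[OF G(1) that(2)] G(3) by simp
    ultimately show ?thesis
      unfolding c_def using degree_sum_le[OF G(1,2) that(1)] G(3)
      by (intro divide_right_mono edge_weight_le[OF mono] bound) auto
  qed
  have "Q f G \<le> (\<Sum>e\<in>snd G. \<Sum>x\<in>e. c x)"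
    unfolding Q_def
  proof (rule sum_mono)
    fix e
    assume e: "e \<in> snd G"
    with G(1) obtain u v where uv: "e = {u, v}" "u \<in> fst G" "v \<in> fst G" "u \<noteq> v"
      by (rule simple_graph_edgeE)
    \<comment> \<open>Since \<open>u \<noteq> v\<close>, the inner sum is \<open>c u + c v\<close>;
      symmetry of \<open>f\<close> makes the two halves equal.\<close>
    show "edge_weight f G e \<le> (\<Sum>x\<in>e. c x)"
      using half[of u v] half[of v u] uv e sym[of "degree G u" "degree G v"]
      by (simp add: edge_weight_doubleton[OF sym] insert_commute)
  qed
  also have "\<dots> = (\<Sum>v\<in>fst G. real (degree G v) * c v)"
    by (rule sum_edges_eq_sum_vertices[OF G(1)])
  also have "\<dots> \<le> (\<Sum>v\<in>fst G. M / 2 * (1 / (real n - real (degree G v))))"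
  proof (rule sum_mono)
    fix v
    assume "v \<in> fst G"
    then have "degree G v < n"
      using degree_less_card[OF G(1)] G(3) by simp
    \<comment> \<open>For an isolated vertex the left side is 0 and \<open>M \<ge> 0\<close>
      suffices; otherwise the degree cancels.\<close>
    then show "real (degree G v) * c v \<le> M / 2 * (1 / (real n - real (degree G v)))"
      using \<open>M \<ge> 0\<close> by (cases "degree G v = 0") (simp_all add: c_def mult.commute)
  qed
  also have "\<dots> = M / 2 * (\<Sum>v\<in>fst G. 1 / (real n - real (degree G v)))"
    by (simp add: sum_distrib_left)
  also have "\<dots> \<le> M / 2 * 2"
    using sum_inverse_codegree_le[OF G(1,2)] G(3) \<open>M \<ge> 0\<close> by (intro mult_left_mono) auto
  finally show ?thesis
    by simp
qed

section \<open>Complete bipartite graphs\<close>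

lemma complete_bipartite_eq: "complete_bipartite a b = bipartite_on {0..<a} {a..<a + b}"
  by (auto simp: complete_bipartite_def bipartite_on_def)

lemma simple_graph_bipartite_on:
  assumes "finite A" "finite B" "A \<inter> B = {}"
  shows "simple_graph (bipartite_on A B)"
  using assms by (fastforce simp: simple_graph_def bipartite_on_def)

lemma doubleton_in_bipartite_on:
  "{x, y} \<in> snd (bipartite_on A B) \<longleftrightarrow> x \<in> A \<and> y \<in> B \<or> x \<in> B \<and> y \<in> A"
  by (auto simp: bipartite_on_def doubleton_eq_iff)

lemma triangle_free_bipartite_on:
  assumes "A \<inter> B = {}"
  shows "triangle_free (bipartite_on A B)"
  unfolding triangle_free_def doubleton_in_bipartite_on using assms by blast

lemma degree_bipartite_on:
  assumes "A \<inter> B = {}"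
  shows "a \<in> A \<Longrightarrow> degree (bipartite_on A B) a = card B"
    and "b \<in> B \<Longrightarrow> degree (bipartite_on A B) b = card A"
  unfolding degree_def doubleton_in_bipartite_on using assms
  by (auto simp: bipartite_on_def intro!: arg_cong[where f = card])

text \<open>Disjointness lets each edge come from exactly one pair in \<open>A \<times> B\<close>,
  and all edges have the same weight.\<close>

lemma Q_bipartite_on:
  fixes f :: "nat \<Rightarrow> nat \<Rightarrow> real"
  assumes sym: "\<And>x y. f x y = f y x" and disj: "A \<inter> B = {}"
  shows "Q f (bipartite_on A B) = real (card A * card B) * f (card A) (card B)"
proof -
  let ?G = "bipartite_on A B"
  have edges: "snd ?G = (\<lambda>(a, b). {a, b}) ` (A \<times> B)"
    by (auto simp: bipartite_on_def)
  have "inj_on (\<lambda>(a, b). {a, b}) (A \<times> B)"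
    using disj by (auto simp: inj_on_def doubleton_eq_iff)
  then have "card (snd ?G) = card A * card B"
    unfolding edges by (simp add: card_image card_cartesian_product)
  moreover have "edge_weight f ?G e = f (card A) (card B)" if "e \<in> snd ?G" for e
    using that degree_bipartite_on[OF disj] sym[of "card A" "card B"]
    by (auto simp: edges edge_weight_doubleton[OF sym])
  ultimately show ?thesis
    by (simp add: Q_def)
qed

section \<open>The maximum is attained\<close>

theorem theorem1p5:
  fixes f :: "nat \<Rightarrow> nat \<Rightarrow> real" and n :: nat
  assumes "\<And>x y. f x y = f y x"
    and "\<And>x x' y y'. x \<le> x' \<Longrightarrow> y \<le> y' \<Longrightarrow> f x y \<le> f x' y'"
  shows "\<exists>m\<le>n. \<forall>V :: 'a set. finite V \<and> card V = n \<longrightarrow>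
    Max {Q f G | G. simple_graph G \<and> fst G = V \<and> triangle_free G}
      = Q f (complete_bipartite m (n - m))"
proof -
  \<comment> \<open>The value of \<open>Q f\<close> on the complete bipartite graph with parts
    \<open>m\<close> and \<open>n - m\<close>. Its maximiser depends on \<open>f\<close> and
    \<open>n\<close> only, so one \<open>m\<close> serves every \<open>V\<close>.\<close>
  define q where "q m = real (m * (n - m)) * f m (n - m)" for m
  have "Max (q ` {..n}) \<in> q ` {..n}"
    by (intro Max_in) auto
  then obtain m where m: "m \<le> n" "Max (q ` {..n}) = q m"
    by (metis atMost_iff imageE)
  have q_le: "q k \<le> q m" if "k \<le> n" for k
    using that by (simp flip: m(2))
  have "Q f (complete_bipartite m (n - m)) = q m"
    using Q_bipartite_on[OF assms(1), of "{0..<m}" "{m..<m + (n - m)}"]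
    by (simp add: complete_bipartite_eq q_def)
  moreover have "Max {Q f G | G. simple_graph G \<and> fst G = V \<and> triangle_free G} = q m"
    if V: "finite V" "card V = n" for V :: "'a set"
  proof (rule Max_eqI)
    \<comment> \<open>\<open>Max\<close> is meaningful only on a finite set: there are finitely many
      simple graphs on \<open>V\<close>.\<close>
    have "{G. simple_graph G \<and> fst G = V} \<subseteq> {V} \<times> Pow (Pow V)"
      by (fastforce elim: simple_graph_edgeE)
    then have "finite {G. simple_graph G \<and> fst G = V}"
      by (rule finite_subset) (use V(1) in simp)
    then have "finite (Q f ` {G. simple_graph G \<and> fst G = V})"
      by (rule finite_imageI)
    then show "finite {Q f G | G. simple_graph G \<and> fst G = V \<and> triangle_free G}"
      by (rule rev_finite_subset) auto
  next
    fix y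
    assume "y \<in> {Q f G | G. simple_graph G \<and> fst G = V \<and> triangle_free G}"
    then obtain G where G: "y = Q f G" "simple_graph G" "fst G = V" "triangle_free G"
      by blast
    then show "y \<le> q m"
      using Q_le[OF assms G(2,4), where n = n and M = "q m"] V(2) q_le by (simp add: q_def)
  next
    \<comment> \<open>Splitting \<open>V\<close> into parts of sizes \<open>m\<close> and
      \<open>n - m\<close> puts a copy of the extremal graph on \<open>V\<close> itself.\<close>
    obtain A where A: "A \<subseteq> V" "card A = m"
      using obtain_subset_with_card_n[of m V] m(1) V(2) by auto
    have fin: "finite A"
      using A(1) V(1) by (rule finite_subset)
    have "card (V - A) = n - m"
      using A V fin by (simp add: card_Diff_subset)
    then have "q m = Q f (bipartite_on A (V - A))"
      using Q_bipartite_on[OF assms(1), of A "V - A"] A(2) by (simp add: q_def)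
    moreover have "fst (bipartite_on A (V - A)) = V"
      using A(1) by (auto simp: bipartite_on_def)
    moreover have "simple_graph (bipartite_on A (V - A))" "triangle_free (bipartite_on A (V - A))"
      using fin V(1) by (auto intro: simple_graph_bipartite_on triangle_free_bipartite_on)
    ultimately show "q m \<in> {Q f G | G. simple_graph G \<and> fst G = V \<and> triangle_free G}"
      by blast
  qed
  ultimately show ?thesis
    using m(1) by auto
qed

end
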